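(* Let $n\ge0$ and let $$m_{i,j}=(-1)^j\,{}_3F_2\!\left[\begin{matrix}-j,\;1+j,\;-i\\ 1,\;-n\end{matrix};1\right],\qquad 0\le i,j\le n,$$ be the elements of the change of basis matrix from shifted Legendre polynomials to Bernstein polynomials. Let $$l_k(i)=\prod_{\substack{v=0\\ v\ne k}}^{n}\frac{i-v}{k-v},\qquad 0\le k\le n,$$ be the Lagrange interpolation polynomials. Then for each $j$ with $0\le j\le n$, as polynomials in $i$, $$(-1)^j\,{}_3F_2\!\left[\begin{matrix}-j,\;1+j,\;-i\\ 1,\;-n\end{matrix};1\right]=\sum_{v=0}^{n}m_{v,j}\,l_v(i).$$
   Context: The hypergeometric series is the terminating sum ${}_3F_2\!\left[\begin{matrix}-j,1+j,-i\\1,-n\end{matrix};1\right]=\sum_{v=0}^{j}\frac{(-j)_v(1+j)_v(-i)_v}{(1)_v(-n)_v\,v!}$ with $(a)_v=a(a+1)\cdots(a+v-1)$; for fixed $j\le n$ it is a polynomial in $i$. The change of basis matrix $(m_{i,j})$ satisfies $P_j^*(x)=\sum_{i=0}^n m_{i,j}b_i^n(x)$, where $P_j^*(x)=P_j(2x-1)$ is the shifted Legendre polynomial and $b_i^n(x)=\binom{n}{i}x^i(1-x)^{n-i}$. *)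

theory Defs
  imports "HOL-Analysis.Weierstrass_Theorems" "HOL-Computational_Algebra.Polynomial"
begin

text \<open>Terminating series with upper parameters \<open>-j, b, c\<close> and lower parameters \<open>d, e\<close>. The sum
  is cut off explicitly at \<open>v = j\<close>, since for a nonpositive integer \<open>e\<close> later terms would divide
  by zero.\<close>

definition hyp3F2 :: "nat \<Rightarrow> real \<Rightarrow> real \<Rightarrow> real \<Rightarrow> real \<Rightarrow> real \<Rightarrow> real" where
  "hyp3F2 j b c d e z =
     (\<Sum>v=0..j. pochhammer (- real j) v * pochhammer b v * pochhammer c v
        / (pochhammer d v * pochhammer e v * fact v) * z ^ v)"

text \<open>The same series with \<open>b = 1 + j\<close>, \<open>d = 1\<close>, \<open>e = -n\<close>, \<open>z = 1\<close>, as a polynomial in the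
  indeterminate \<open>i\<close> where \<open>c = -i\<close>.\<close>

definition hyp3F2_poly :: "nat \<Rightarrow> nat \<Rightarrow> real poly" where
  "hyp3F2_poly n j =
     (\<Sum>v=0..j. smult (pochhammer (- real j) v * pochhammer (1 + real j) v
        / (pochhammer 1 v * pochhammer (- real n) v * fact v)) (pochhammer [:0, -1:] v))"

lemma poly_pochhammer: "poly (pochhammer p v) x = pochhammer (poly p x) v"
  for p :: "'a::comm_ring_1 poly"
  by (induction v) (simp_all add: pochhammer_Suc)

lemma poly_hyp3F2_poly:
  "poly (hyp3F2_poly n j) x = hyp3F2 j (1 + real j) (- x) 1 (- real n) 1"
  by (simp add: hyp3F2_poly_def hyp3F2_def poly_sum poly_pochhammer)

definition lagrange_poly :: "nat \<Rightarrow> nat \<Rightarrow> real poly" where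
  "lagrange_poly n k =
     (\<Prod>v\<in>{0..n} - {k}. smult (1 / (real k - real v)) [:- real v, 1:])"

lemma poly_lagrange_poly:
  "poly (lagrange_poly n k) x = (\<Prod>v\<in>{0..n} - {k}. (x - real v) / (real k - real v))"
  by (simp add: lagrange_poly_def poly_prod diff_divide_distrib)

text \<open>Rodrigues' formula; in particular \<open>P\<^sub>j(1) = 1\<close>.\<close>

definition legendre_poly :: "nat \<Rightarrow> real poly" where
  "legendre_poly j = smult (1 / (2 ^ j * fact j)) ((pderiv ^^ j) ([:-1, 0, 1:] ^ j))"

definition shifted_legendre_poly :: "nat \<Rightarrow> real poly" where
  "shifted_legendre_poly j = pcompose (legendre_poly j) [:-1, 2:]"

end

theory Submission
  imports Defs
begin

text \<open>Both parts rest on rewriting the series in binomial coefficients. At \<open>c = -i\<close> and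
  \<open>e = -n\<close> the sign and the factorial of the two Pochhammer symbols cancel, so that their
  quotient is \<open>binom(i,v) / binom(n,v)\<close>, and
  \[ m_{i,j} = (-1)^j \sum_{v=0}^{j} (-1)^v \binom{j}{v} \binom{j+v}{v}
       \binom{i}{v} / \binom{n}{v}. \]

  The factor that depends on \<open>i\<close> is the Bernstein coefficient of a monomial: the \<open>v\<close>-th factorial
  moment of the binomial distribution says \<open>\<Sum>\<^sub>i binom(i,v) b\<^sub>i\<^sup>n(x) = binom(n,v) x\<^sup>v\<close>
  (lemma \<open>sum_choose_Bernstein\<close>). Summing \<open>m\<^sub>i\<^sub>j b\<^sub>i\<^sup>n(x)\<close> over \<open>i\<close> hence replaces
  that factor by \<open>x\<^sup>v\<close>, and what remains is the monomial expansion of \<open>P\<^sub>j(2x-1)\<close>. That expansion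
  (lemma \<open>coeff_shifted_legendre_poly\<close>) comes from Rodrigues' formula, which after the substitution
  reads \<open>(1/j!) D\<^sup>j (x\<^sup>2 - x)\<^sup>j\<close>, by the binomial theorem for \<open>x\<^sup>j (x - 1)\<^sup>j\<close>.

  The interpolation identity is then the uniqueness of the interpolating polynomial: as a
  polynomial in \<open>i\<close> the series has degree at most \<open>j \<le> n\<close>, and its values at the nodes
  \<open>0, \<dots>, n\<close> are the \<open>m\<^sub>i\<^sub>j\<close> (lemma \<open>lagrange_interpolation\<close>).\<close>

section \<open>The terminating series in binomial coefficients\<close>

lemma pochhammer_uminus_of_nat:
  "pochhammer (- real i) v = (-1) ^ v * fact v * real (i choose v)"
  by (simp add: binomial_gbinomial gbinomial_pochhammer flip: power_add mult_2 mult.assoc)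

lemma pochhammer_Suc_of_nat:
  "pochhammer (1 + real j) v = fact v * real ((j + v) choose v)"
  by (simp add: binomial_gbinomial gbinomial_pochhammer' add.commute)

lemma hyp3F2_eq_sum_choose:
  assumes "j \<le> n"
  shows "hyp3F2 j (1 + real j) (- real i) 1 (- real n) 1 =
    (\<Sum>v=0..j. (-1) ^ v * real (j choose v) * real ((j + v) choose v)
       * real (i choose v) / real (n choose v))"
  unfolding hyp3F2_def
proof (rule sum.cong)
  fix v assume "v \<in> {0..j}"
  \<comment> \<open>\<open>v \<le> n\<close> keeps the denominator away from \<open>0\<close>.\<close>
  then have "real (n choose v) \<noteq> 0"
    using assms by simp
  then show "pochhammer (- real j) v * pochhammer (1 + real j) v * pochhammer (- real i) v
      / (pochhammer 1 v * pochhammer (- real n) v * fact v) * 1 ^ v =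
    (-1) ^ v * real (j choose v) * real ((j + v) choose v)
       * real (i choose v) / real (n choose v)"
    by (simp add: pochhammer_uminus_of_nat pochhammer_Suc_of_nat pochhammer_fact [symmetric]
        field_simps)
qed simp

section \<open>Monomials in the Bernstein basis\<close>

text \<open>Since \<open>binom(n,i) binom(i,v) = binom(n,v) binom(n-v,i-v)\<close>, the sum is \<open>binom(n,v) x\<^sup>v\<close> times
  the sum of all Bernstein polynomials of degree \<open>n - v\<close>, which is \<open>1\<close>.\<close>

lemma sum_choose_Bernstein:
  assumes "v \<le> n"
  shows "(\<Sum>i=0..n. real (i choose v) * Bernstein n i x) = real (n choose v) * x ^ v"
proof -
  have "(\<Sum>i=0..n. real (i choose v) * Bernstein n i x)
      = (\<Sum>i=v..n. real (i choose v) * Bernstein n i x)"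
    by (rule sum.mono_neutral_right) (auto simp: not_le)
  also have "\<dots> = (\<Sum>k=0..n-v. real ((k + v) choose v) * Bernstein n (k + v) x)"
    using sum.shift_bounds_cl_nat_ivl[of "\<lambda>i. real (i choose v) * Bernstein n i x" 0 v "n - v"]
      assms by simp
  also have "\<dots> = (\<Sum>k=0..n-v. real (n choose v) * x ^ v * Bernstein (n - v) k x)"
  proof (rule sum.cong)
    fix k assume "k \<in> {0..n-v}"
    then have "(n choose (k + v)) * ((k + v) choose v) = (n choose v) * ((n - v) choose k)"
      using choose_mult[of v "k + v" n] assms by simp
    then have "real ((k + v) choose v) * real (n choose (k + v))
        = real (n choose v) * real ((n - v) choose k)"
      by (metis of_nat_mult mult.commute)
    then show "real ((k + v) choose v) * Bernstein n (k + v) x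
        = real (n choose v) * x ^ v * Bernstein (n - v) k x"
      by (simp add: Bernstein_def power_add add.commute flip: mult.assoc)
  qed simp
  also have "\<dots> = real (n choose v) * x ^ v"
    by (simp add: atLeast0AtMost flip: sum_distrib_left)
  finally show ?thesis .
qed

section \<open>Shifted Legendre polynomials in the monomial basis\<close>

lemma higher_pderiv_pcompose_linear:
  fixes p :: "'a::{comm_semiring_1,semiring_no_zero_divisors,semiring_char_0} poly"
  shows "(pderiv ^^ k) (pcompose p [:a, b:]) = smult (b ^ k) (pcompose ((pderiv ^^ k) p) [:a, b:])"
  by (induction k) (simp_all add: pderiv_smult pderiv_pcompose pderiv_pCons mult.commute)

text \<open>The substitution \<open>y = 2x - 1\<close> turns \<open>y\<^sup>2 - 1\<close> into \<open>4x(x - 1)\<close> and costs a factor \<open>2\<close> per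
  derivative; \<open>4\<^sup>j\<close> against \<open>2\<^sup>j 2\<^sup>j\<close> leaves only the factorial.\<close>

lemma shifted_legendre_poly_rodrigues:
  "shifted_legendre_poly j =
     smult (1 / fact j) ((pderiv ^^ j) (monom 1 j * [:-1, 1:] ^ j))"
proof -
  have "pcompose ([:-1, 0, 1:] ^ j) [:-1, 2:] = pcompose [:-1, 0, 1 :: real:] [:-1, 2:] ^ j"
    by (induction j) (simp_all only: power_0 power_Suc pcompose_mult pcompose_1)
  also have "pcompose [:-1, 0, 1:] [:-1, 2:] = [:0, -4, 4 :: real:]"
    by (simp add: pcompose_pCons)
  also have "[:0, -4, 4:] = smult 4 (monom 1 1 * [:-1, 1 :: real:])"
    by (simp add: monom_Suc monom_0)
  also have "\<dots> ^ j = smult (4 ^ j) (monom 1 j * [:-1, 1:] ^ j)"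
    by (simp only: smult_power power_mult_distrib monom_power power_one mult_1)
  finally have "smult (2 ^ j) (pcompose ((pderiv ^^ j) ([:-1, 0, 1:] ^ j)) [:-1, 2:])
      = smult (4 ^ j) ((pderiv ^^ j) (monom 1 j * [:-1, 1 :: real:] ^ j))"
    by (metis higher_pderiv_pcompose_linear higher_pderiv_smult)
  then have "smult (1 / (2 ^ j * 2 ^ j * fact j)) (smult (2 ^ j)
        (pcompose ((pderiv ^^ j) ([:-1, 0, 1:] ^ j)) [:-1, 2:]))
      = smult (1 / (2 ^ j * 2 ^ j * fact j)) (smult (4 ^ j)
        ((pderiv ^^ j) (monom 1 j * [:-1, 1 :: real:] ^ j)))"
    by simp
  moreover have "(4::real) ^ j = 2 ^ j * 2 ^ j"
    by (simp flip: power_mult_distrib)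
  ultimately show ?thesis
    by (simp add: shifted_legendre_poly_def legendre_poly_def pcompose_smult)
qed

lemma degree_shifted_legendre_poly: "degree (shifted_legendre_poly j) \<le> j"
proof -
  have "degree (monom (1::real) j * [:-1, 1:] ^ j) = j + j"
    by (simp add: degree_mult_eq degree_monom_eq degree_power_eq)
  then show ?thesis
    by (simp add: shifted_legendre_poly_rodrigues degree_higher_pderiv)
qed

text \<open>The factor \<open>x\<^sup>j\<close> and the \<open>j\<close> derivatives shift the degree in opposite directions, so the
  coefficient of \<open>x\<^sup>v\<close> comes from the term of \<open>(x - 1)\<^sup>j\<close> of the same degree, multiplied by
  \<open>(v + 1)\<cdots>(v + j) = j! binom(j+v,v)\<close>.\<close>

lemma coeff_shifted_legendre_poly:
  assumes "v \<le> j"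
  shows "coeff (shifted_legendre_poly j) v =
    (-1) ^ (j + v) * real (j choose v) * real ((j + v) choose v)"
proof -
  have "pochhammer (1 + real v) j = fact j * real ((j + v) choose v)"
    using binomial_symmetric[of j "j + v"] by (simp add: pochhammer_Suc_of_nat add.commute)
  moreover have "(-1 :: real) ^ (j - v) = (-1) ^ (j + v)"
    using assms by (simp add: uminus_power_if)
  ultimately show ?thesis
    using assms by (simp add: shifted_legendre_poly_rodrigues coeff_higher_pderiv
        coeff_monom_mult coeff_linear_poly_power)
qed

lemma poly_shifted_legendre_poly:
  "poly (shifted_legendre_poly j) x =
     (\<Sum>v=0..j. (-1) ^ (j + v) * real (j choose v) * real ((j + v) choose v) * x ^ v)"
proof -
  have "poly (shifted_legendre_poly j) x =
      poly (\<Sum>v\<le>j. monom (coeff (shifted_legendre_poly j) v) v) x"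
    by (simp add: poly_as_sum_of_monoms' degree_shifted_legendre_poly)
  then show ?thesis
    by (simp add: poly_sum poly_monom coeff_shifted_legendre_poly atLeast0AtMost)
qed

section \<open>Lagrange interpolation at the nodes 0, ..., n\<close>

lemma poly_lagrange_poly_node:
  assumes "i \<le> n"
  shows "poly (lagrange_poly n k) (real i) = (if i = k then 1 else 0)"
  using assms by (auto simp: poly_lagrange_poly)

lemma degree_lagrange_poly:
  assumes "k \<le> n"
  shows "degree (lagrange_poly n k) \<le> n"
proof -
  have "degree (lagrange_poly n k) \<le>
      (\<Sum>v\<in>{0..n}-{k}. degree (smult (1 / (real k - real v)) [:- real v, 1:]))"
    using degree_prod_sum_le[of "{0..n}-{k}"
        "\<lambda>v. smult (1 / (real k - real v)) [:- real v, 1:]"]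
    by (simp add: lagrange_poly_def o_def)
  also have "\<dots> \<le> (\<Sum>v\<in>{0..n}-{k}. 1)"
    by (rule sum_mono) simp
  also have "\<dots> = n"
    using assms by simp
  finally show ?thesis .
qed

text \<open>Both sides have degree at most \<open>n\<close> and agree at \<open>n + 1\<close> points.\<close>

lemma lagrange_interpolation:
  assumes "degree p \<le> n"
  shows "p = (\<Sum>k=0..n. smult (poly p (real k)) (lagrange_poly n k))" (is "_ = ?q")
proof (rule poly_eqI_degree)
  show "poly p x = poly ?q x" if "x \<in> real ` {0..n}" for x
    using that by (auto simp: poly_sum poly_lagrange_poly_node if_distrib sum.delta cong: if_cong)
  have "card (real ` {0..n}) = Suc n"
    by (simp add: card_image)
  moreover have "degree ?q \<le> n"
    by (intro degree_sum_le) (auto intro: order.trans[OF degree_smult_le] degree_lagrange_poly)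
  ultimately show "card (real ` {0..n}) > degree p" "card (real ` {0..n}) > degree ?q"
    using assms by auto
qed

lemma degree_pochhammer_le:
  fixes p :: "'a::comm_semiring_1 poly"
  assumes "degree p \<le> 1"
  shows "degree (pochhammer p v) \<le> v"
proof (induction v)
  case (Suc v)
  have "degree (p + of_nat v) \<le> 1"
    using assms by (intro degree_add_le) simp_all
  then show ?case
    using Suc degree_mult_le[of "pochhammer p v" "p + of_nat v"] by (simp add: pochhammer_Suc)
qed simp

lemma degree_hyp3F2_poly: "degree (hyp3F2_poly n j) \<le> j"
  unfolding hyp3F2_poly_def
proof (rule degree_sum_le)
  fix v assume "v \<in> {0..j}"
  moreover have "degree (pochhammer [:0, -1 :: real:] v) \<le> v"
    by (rule degree_pochhammer_le) simp
  ultimately show "degree (smult (pochhammer (- real j) v * pochhammer (1 + real j) v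
      / (pochhammer 1 v * pochhammer (- real n) v * fact v)) (pochhammer [:0, -1:] v)) \<le> j"
    by (auto intro: order.trans[OF degree_smult_le])
qed simp

section \<open>The change of basis matrix and its interpolation\<close>

theorem lemma5:
  fixes n j :: nat and m :: "nat \<Rightarrow> nat \<Rightarrow> real"
  assumes m: "\<And>i j. i \<le> n \<Longrightarrow> j \<le> n \<Longrightarrow>
                m i j = (-1) ^ j * hyp3F2 j (1 + real j) (- real i) 1 (- real n) 1"
    and j: "j \<le> n"
  shows "(\<forall>x. poly (shifted_legendre_poly j) x = (\<Sum>i=0..n. m i j * Bernstein n i x)) \<and>
         smult ((-1) ^ j) (hyp3F2_poly n j) = (\<Sum>v=0..n. smult (m v j) (lagrange_poly n v))"
proof (intro conjI allI)
  fix x :: real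
  define c where "c v = (-1) ^ (j + v) * real (j choose v) * real ((j + v) choose v)" for v
  have "(\<Sum>i=0..n. m i j * Bernstein n i x) =
      (\<Sum>i=0..n. \<Sum>v=0..j. c v / real (n choose v) * (real (i choose v) * Bernstein n i x))"
    using j by (intro sum.cong)
      (simp_all add: m hyp3F2_eq_sum_choose c_def sum_distrib_left sum_distrib_right
        power_add mult_ac)
  also have "\<dots> = (\<Sum>v=0..j. c v / real (n choose v)
      * (\<Sum>i=0..n. real (i choose v) * Bernstein n i x))"
    by (subst sum.swap) (simp add: sum_distrib_left)
  also have "\<dots> = (\<Sum>v=0..j. c v * x ^ v)"
    using j by (intro sum.cong) (simp_all add: sum_choose_Bernstein)
  finally show "poly (shifted_legendre_poly j) x = (\<Sum>i=0..n. m i j * Bernstein n i x)"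
    by (simp add: poly_shifted_legendre_poly c_def)
next
  have "degree (smult ((-1) ^ j) (hyp3F2_poly n j)) \<le> n"
    using degree_hyp3F2_poly[of n j] j by (meson degree_smult_le order.trans)
  then have "smult ((-1) ^ j) (hyp3F2_poly n j) =
      (\<Sum>v=0..n. smult (poly (smult ((-1) ^ j) (hyp3F2_poly n j)) (real v)) (lagrange_poly n v))"
    by (rule lagrange_interpolation)
  also have "\<dots> = (\<Sum>v=0..n. smult (m v j) (lagrange_poly n v))"
    using j by (intro sum.cong) (simp_all add: m poly_hyp3F2_poly)
  finally show "smult ((-1) ^ j) (hyp3F2_poly n j)
      = (\<Sum>v=0..n. smult (m v j) (lagrange_poly n v))" .
qed

end
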